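(* Let $\mathcal{H}$ be a real Hilbert space, let $l:\mathcal{H}\to\mathbb{R}$ and $r:\mathcal{H}\to\mathbb{R}$ be proper, convex and lower semicontinuous, and let $f=l+r$. Assume that $\mathcal{X}=\{z\in\mathcal{H}: f(z)=\min_{x\in\mathcal{H}} f(x)\}$ is nonempty and put $f_*=\min_{x\in\mathcal{H}} f(x)$. Let $\alpha\in\left]0,+\infty\right[$, $\theta\in\left]0,1\right[$, and $\alpha_t=\alpha\,t^{-\theta}$ for every $t\in\mathbb{N}^*$. Let $x_1\in\mathcal{H}$ and let the sequences $\{x_t\}_{t\geq1}$, $\{y_t\}_{t\geq2}$, $\{z_t\}_{t\geq2}$ be generated by the Douglas–Rachford iteration: for every $t\in\mathbb{N}^*$, $$y_{t+1}=\operatorname{prox}_{\alpha_t l}(x_t),\qquad z_{t+1}=\operatorname{prox}_{\alpha_t r}(2y_{t+1}-x_t),\qquad x_{t+1}=x_t+z_{t+1}-y_{t+1}.$$ Assume that there exists $B\in\left]0,+\infty\right[$ such that $\|g\|\leq B$ for every $g\in\partial l(x_t)\cup\partial r(x_t)$ with $t\geq1$ and every $g\in\partial l(y_t)\cup\partial r(z_t)$ with $t\geq2$. Then, for every $T\in\mathbb{N}$ with $T>3$, $$f(x_T)-f_*\;\leq\;\frac{d(x_1,\mathcal{X})^2}{2\alpha}\,T^{\theta-1}+8\,\alpha\,B^2\,c_{2\theta}\,(\log T)^{\mathbf{1}_{\{2\theta\leq1\}}}\,T^{-\min\{\theta,1-\theta\}} .$$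
   Context: $\mathbb{N}^*=\mathbb{N}\setminus\{0\}$; $d(x,S)=\inf_{x'\in S}\|x-x'\|$; $\log$ is the natural logarithm; $\mathbf{1}_{\{2\theta\leq1\}}$ equals $1$ if $2\theta\leq 1$ and $0$ otherwise. For convex $h:\mathcal{H}\to\mathbb{R}$, $\partial h(x)=\{u\in\mathcal{H}: \forall y\in\mathcal{H},\ h(x)+\langle u,y-x\rangle\leq h(y)\}$. For $h$ proper, lower semicontinuous and convex, $\operatorname{prox}_h(x)=\operatorname{argmin}_{y\in\mathcal{H}}\{h(y)+\tfrac12\|y-x\|^2\}$. The constant is $c_q=5+\frac{2}{1-q}$ if $0\le q<1$, $c_q=9$ if $q=1$, and $c_q=\frac{2^q+3q-1}{q-1}$ if $q>1$. *)

theory Defs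
  imports "HOL-Analysis.Analysis"
begin

definition lower_semicontinuous :: "('a::topological_space \<Rightarrow> real) \<Rightarrow> bool" where
  "lower_semicontinuous h \<longleftrightarrow> (\<forall>x. \<forall>a < h x. \<forall>\<^sub>F y in nhds x. a < h y)"

definition subdifferential :: "('a::real_inner \<Rightarrow> real) \<Rightarrow> 'a \<Rightarrow> 'a set" where
  "subdifferential h x = {u. \<forall>y. h x + u \<bullet> (y - x) \<le> h y}"

(* The minimizer exists and is unique when h is convex and lower semicontinuous on a Hilbert
   space; only then is the value of the underlying choice operator meaningful. *)
definition prox :: "('a::real_inner \<Rightarrow> real) \<Rightarrow> 'a \<Rightarrow> 'a" where
  "prox h x = (ARG_MIN (\<lambda>y. h y + (1/2) * (norm (y - x))\<^sup>2) y. True)"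

definition minimizers :: "('a \<Rightarrow> real) \<Rightarrow> 'a set" where
  "minimizers f = {z. is_arg_min f (\<lambda>_. True) z}"

(* Agrees with the minimum only when it is attained, i.e. when minimizers f is nonempty. *)
definition min_value :: "('a \<Rightarrow> real) \<Rightarrow> real" where
  "min_value f = (INF x. f x)"

(* Intended for q >= 0. *)
definition c_const :: "real \<Rightarrow> real" where
  "c_const q = (if q < 1 then 5 + 2 / (1 - q)
                else if q = 1 then 9
                else (2 powr q + 3 * q - 1) / (q - 1))"

end

theory Submission
  imports Defs
begin

text \<open>
  The proximal residuals \<open>g\<^sub>l = (x\<^sub>t - y\<^sub>t\<^sub>+\<^sub>1) / \<alpha>\<^sub>t\<close> and
  \<open>g\<^sub>r = (2 y\<^sub>t\<^sub>+\<^sub>1 - x\<^sub>t - z\<^sub>t\<^sub>+\<^sub>1) / \<alpha>\<^sub>t\<close> are subgradients of \<open>l\<close> at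
  \<open>y\<^sub>t\<^sub>+\<^sub>1\<close> and of \<open>r\<close> at \<open>z\<^sub>t\<^sub>+\<^sub>1\<close>, and the iteration reads
  \<open>x\<^sub>t\<^sub>+\<^sub>1 = x\<^sub>t - \<alpha>\<^sub>t (g\<^sub>l + g\<^sub>r)\<close>. So Douglas--Rachford is a subgradient method for
  \<open>f = l + r\<close>, except that the subgradients are taken at points that lie within
  \<open>O(\<alpha>\<^sub>t B)\<close> of \<open>x\<^sub>t\<close>. Subgradients at \<open>x\<^sub>t\<close> itself, also bounded by \<open>B\<close>, control the
  error of moving back to \<open>x\<^sub>t\<close>, and for every \<open>u\<close>
  \<open>\<parallel>x\<^sub>t\<^sub>+\<^sub>1 - u\<parallel>\<^sup>2 \<le> \<parallel>x\<^sub>t - u\<parallel>\<^sup>2 - 2 \<alpha>\<^sub>t (f x\<^sub>t - f u) + 8 B\<^sup>2 \<alpha>\<^sub>t\<^sup>2\<close>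
  (\<open>douglas_rachford_descent\<close>).

  Because this holds for every \<open>u\<close>, earlier iterates may serve as \<open>u\<close>. Comparing the averages
  of \<open>2 \<alpha>\<^sub>t (f x\<^sub>t - f\<^sub>*)\<close> over the last \<open>k\<close> and the last \<open>k + 1\<close> indices, with \<open>u = x\<^sub>T\<^sub>-\<^sub>k\<close>,
  turns a bound on the average over all indices into a bound on the last term
  (\<open>last_iterate_bound\<close>). The price is the error \<open>\<alpha>\<^sub>T\<^sup>2 + \<Sum>\<^sub>j \<alpha>\<^sub>T\<^sub>-\<^sub>j\<^sup>2 / j\<close>, which for
  \<open>\<alpha>\<^sub>t = \<alpha> t\<^sup>-\<^sup>\<theta>\<close> is \<open>\<alpha>\<^sup>2\<close> times a convolution of \<open>t\<^sup>-\<^sup>2\<^sup>\<theta>\<close> with \<open>1 / j\<close>. Either \<open>j \<le> T / 2\<close>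
  or \<open>T - j \<le> T / 2\<close>, so one of the two factors is always within a constant of its value at
  \<open>T\<close>; this yields the stated rate (\<open>weighted_step_sum_rate\<close>).

  Two existence facts make the argument meaningful. A real-valued convex lower semicontinuous
  \<open>h\<close> on a Hilbert space is bounded above on some ball by Baire's theorem, hence on a ball
  around any point \<open>x\<close>, and convexity turns this into \<open>h u \<ge> h x - K \<parallel>u - x\<parallel>\<close> for all \<open>u\<close>.
  This lower bound makes the proximal objective bounded below, so that minimizing sequences
  converge by strong convexity. It also bounds the residuals
  \<open>(x - prox (\<lambda> h) x) / \<lambda>\<close> by \<open>K\<close>, and these converge in norm to a subgradient at \<open>x\<close> as
  \<open>\<lambda>\<close> tends to zero (\<open>subdifferential_nonempty\<close>).
\<close>

section \<open>Convex lower semicontinuous functions on a Hilbert space\<close>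

lemma lower_semicontinuous_le_limit:
  fixes h :: "'a::topological_space \<Rightarrow> real"
  assumes "lower_semicontinuous h" "u \<longlonglongrightarrow> v" "b \<longlonglongrightarrow> c" "\<And>n. h (u n) \<le> b n"
  shows "h v \<le> c"
proof (rule ccontr)
  assume "\<not> h v \<le> c"
  then obtain a where a: "c < a" "a < h v"
    by (meson dense not_le)
  have "\<forall>\<^sub>F w in nhds v. a < h w"
    using assms(1) a(2) by (simp add: lower_semicontinuous_def)
  then have "\<forall>\<^sub>F n in sequentially. a < h (u n)"
    using assms(2) by (rule eventually_compose_filterlim)
  moreover have "\<forall>\<^sub>F n in sequentially. b n < a"
    using assms(3) a(1) by (rule order_tendstoD)
  ultimately have "\<forall>\<^sub>F n in sequentially. a < h (u n) \<and> b n < a"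
    by (rule eventually_conj)
  then obtain n where "a < h (u n)" "b n < a"
    using eventually_happens[of _ sequentially] by auto
  with assms(4)[of n] show False by simp
qed

lemma lower_semicontinuous_closed_sublevel:
  assumes "lower_semicontinuous h"
  shows "closed {u. h u \<le> c}"
proof -
  have "open {u. c < h u}"
  proof (subst open_subopen, intro ballI)
    fix v assume "v \<in> {u. c < h u}"
    then have "\<forall>\<^sub>F w in nhds v. c < h w"
      using assms by (simp add: lower_semicontinuous_def)
    then show "\<exists>S. open S \<and> v \<in> S \<and> S \<subseteq> {u. c < h u}"
      by (auto simp: eventually_nhds)
  qed
  moreover have "- {u. h u \<le> c} = {u. c < h u}" by auto
  ultimately show ?thesis by (simp add: closed_def)
qed

lemma lower_semicontinuous_cmult:
  assumes "lower_semicontinuous h" "0 < c"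
  shows "lower_semicontinuous (\<lambda>u. c * h u)"
  unfolding lower_semicontinuous_def
proof (intro allI impI)
  fix x a assume "a < c * h x"
  then have "a / c < h x" using assms(2) by (simp add: field_simps)
  then have "\<forall>\<^sub>F y in nhds x. a / c < h y"
    using assms(1) unfolding lower_semicontinuous_def by blast
  then show "\<forall>\<^sub>F y in nhds x. a < c * h y"
    by eventually_elim (use assms(2) in \<open>simp add: field_simps\<close>)
qed

text \<open>Completeness enters here: the closed sublevel sets of integer height cover the space, so by
  Baire one of them contains a ball around some \<open>x0\<close>. The midpoints of that ball with the reflection
  \<open>2 x - x0\<close> form a ball around \<open>x\<close>, and convexity carries the bound over.\<close>

lemma convex_lsc_bounded_above_near:
  fixes h :: "'a::{real_normed_vector,complete_space} \<Rightarrow> real"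
  assumes "convex_on UNIV h" "lower_semicontinuous h"
  obtains d M where "d > 0" "\<And>v. norm v \<le> d \<Longrightarrow> h (x + v) \<le> M"
proof -
  define S where "S = (\<lambda>n::nat. {u. h u \<le> real n})"
  have "\<exists>n. interior (S n) \<noteq> {}"
  proof (rule ccontr)
    assume "\<not> ?thesis"
    then have "\<And>A. A \<in> range S \<Longrightarrow> closedin euclidean A \<and> euclidean interior_of A = {}"
      using lower_semicontinuous_closed_sublevel[OF assms(2)] by (auto simp: S_def)
    then have "euclidean interior_of (\<Union>(range S)) = {}"
      by (intro Baire_category_alt disjI1 completely_metrizable_space_euclidean) auto
    moreover have "\<Union>(range S) = UNIV"
      using real_arch_simple by (auto simp: S_def)
    ultimately show False by simp
  qed
  then obtain n x0 e where e: "e > 0" "cball x0 e \<subseteq> S n"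
    by (metis equals0I mem_interior_cball)
  define w where "w = 2 *\<^sub>R x - x0"
  show thesis
  proof
    show "e / 2 > 0" using e by simp
    fix v :: 'a assume "norm v \<le> e / 2"
    then have "x0 + 2 *\<^sub>R v \<in> S n"
      using e(2) by (auto simp: subset_iff dist_norm)
    moreover have "x + v = (1 - 1/2) *\<^sub>R w + (1/2) *\<^sub>R (x0 + 2 *\<^sub>R v)"
      by (simp add: w_def algebra_simps)
    then have "h (x + v) \<le> (1 - 1/2) * h w + (1/2) * h (x0 + 2 *\<^sub>R v)"
      using convex_onD[OF assms(1), of "1/2" w "x0 + 2 *\<^sub>R v"] by simp
    ultimately show "h (x + v) \<le> h w / 2 + real n / 2"
      by (simp add: S_def)
  qed
qed

text \<open>The value at \<open>x\<close> lies below the chord from \<open>u\<close> to the point on the opposite side of \<open>x\<close>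
  at distance \<open>d\<close>, where \<open>h\<close> is at most \<open>M\<close>; solving for \<open>h u\<close> gives the slope
  \<open>K = (M - h x) / d\<close>. This global bound stands in for an affine minorant.\<close>

lemma convex_lsc_linear_lower_bound:
  fixes h :: "'a::{real_normed_vector,complete_space} \<Rightarrow> real"
  assumes "convex_on UNIV h" "lower_semicontinuous h"
  obtains K where "K \<ge> 0" "\<And>u. h u \<ge> h x - K * norm (u - x)"
proof -
  obtain d M where d: "d > 0" "\<And>v. norm v \<le> d \<Longrightarrow> h (x + v) \<le> M"
    using convex_lsc_bounded_above_near[OF assms, of x] by blast
  have M: "h x \<le> M" using d(2)[of 0] d(1) by simp
  show thesis
  proof
    show "(M - h x) / d \<ge> 0" using d M by simp
    fix u
    show "h u \<ge> h x - (M - h x) / d * norm (u - x)"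
    proof (cases "u = x")
      case False
      define s where "s = norm (u - x)"
      have s: "s > 0" using False by (simp add: s_def)
      define p where "p = x + (- (d / s)) *\<^sub>R (u - x)"
      have p: "h p \<le> M"
        unfolding p_def using d(1) s by (intro d(2)) (simp add: s_def)
      define t where "t = d / (s + d)"
      have t: "0 \<le> t" "t \<le> 1" "1 - t = s / (s + d)"
        using d(1) s by (auto simp: t_def field_simps)
      have "(1 - t) *\<^sub>R p + t *\<^sub>R u = x + (t - (1 - t) * (d / s)) *\<^sub>R (u - x)"
        by (simp add: p_def algebra_simps)
      also have "t - (1 - t) * (d / s) = 0"
        unfolding t(3) using s d(1) by (simp add: t_def)
      finally have "h x \<le> (1 - t) * h p + t * h u"
        using convex_onD[OF assms(1) t(1,2), of p u] by simp
      also have "\<dots> \<le> (1 - t) * M + t * h u"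
        using p t by (intro add_right_mono mult_left_mono) auto
      also have "\<dots> = (s * M + d * h u) / (s + d)"
        by (simp only: t(3)) (simp add: t_def add_divide_distrib)
      finally have "h x * (s + d) \<le> s * M + d * h u"
        using s d(1) by (simp add: pos_le_divide_eq)
      then show ?thesis
        using d(1) by (simp add: s_def[symmetric] field_simps)
    qed simp
  qed
qed

section \<open>Proximal points\<close>

text \<open>The objective \<open>F\<close> is bounded below because the quadratic term beats the linear lower bound
  on \<open>h\<close>. By the parallelogram law the midpoint of two almost minimal points would go below the
  infimum unless they are close, so minimizing sequences are Cauchy, and lower semicontinuity makes
  their limit a minimizer.\<close>

lemma prox_is_arg_min:
  fixes h :: "'a::{real_inner,complete_space} \<Rightarrow> real"
  assumes "convex_on UNIV h" "lower_semicontinuous h"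
  shows "h (prox h x) + (1/2) * (norm (prox h x - x))\<^sup>2 \<le> h u + (1/2) * (norm (u - x))\<^sup>2"
proof -
  define F where "F = (\<lambda>u. h u + (1/2) * (norm (u - x))\<^sup>2)"
  obtain K where K: "\<And>u. h u \<ge> h x - K * norm (u - x)"
    using convex_lsc_linear_lower_bound[OF assms, of x] by blast
  have "F u \<ge> h x - K\<^sup>2 / 2" for u
  proof -
    have "0 \<le> (norm (u - x) - K)\<^sup>2" by simp
    then show ?thesis using K[of u] by (simp add: F_def power2_eq_square algebra_simps)
  qed
  then have bdd: "bdd_below (range F)" by (rule bdd_belowI2)
  define m where "m = (INF u. F u)"
  have m: "m \<le> F u" for u unfolding m_def by (intro cINF_lower bdd) auto
  have "\<exists>u. F u < m + 1 / real (Suc n)" for n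
    using cINF_less_iff[OF _ bdd, of "m + 1 / real (Suc n)"] by (simp add: m_def)
  then obtain v where v: "\<And>n. F (v n) < m + 1 / real (Suc n)" by metis
  have strong: "(norm (a - b))\<^sup>2 \<le> 4 * (F a - m + (F b - m))" for a b
  proof -
    have mid: "(norm ((1 - 1/2) *\<^sub>R a + (1/2) *\<^sub>R b - x))\<^sup>2
        = (norm (a - x))\<^sup>2 / 2 + (norm (b - x))\<^sup>2 / 2 - (norm (a - b))\<^sup>2 / 4"
      unfolding power2_norm_eq_inner
      by (simp add: inner_diff_left inner_diff_right inner_add_left inner_add_right
          inner_commute field_simps)
    show ?thesis
      using m[of "(1 - 1/2) *\<^sub>R a + (1/2) *\<^sub>R b"] convex_onD[OF assms(1), of "1/2" a b]
      unfolding F_def mid by (simp add: add_divide_distrib diff_divide_distrib)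
  qed
  have "Cauchy v"
  proof (rule metric_CauchyI)
    fix e :: real assume "0 < e"
    then obtain N where N: "1 / real (Suc N) < e\<^sup>2 / 8"
      using nat_approx_posE[of "e\<^sup>2 / 8"] by auto
    have "dist (v a) (v b) < e" if "a \<ge> N" "b \<ge> N" for a b
    proof -
      have "1 / real (Suc k) \<le> 1 / real (Suc N)" if "k \<ge> N" for k
        using that by (simp add: frac_le)
      then have "F (v a) - m < e\<^sup>2 / 8" "F (v b) - m < e\<^sup>2 / 8"
        using N that v[of a] v[of b] by (smt (verit))+
      then have "(norm (v a - v b))\<^sup>2 < e\<^sup>2"
        using strong[of "v a" "v b"] by simp
      then show ?thesis
        using \<open>0 < e\<close> by (simp add: dist_norm power2_less_imp_less)
    qed
    then show "\<exists>M. \<forall>a\<ge>M. \<forall>b\<ge>M. dist (v a) (v b) < e" by blast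
  qed
  then obtain y where y: "v \<longlonglongrightarrow> y" using Cauchy_convergent_iff convergent_def by blast
  have "(\<lambda>n. m + 1 / real (Suc n) - (1/2) * (norm (v n - x))\<^sup>2)
      \<longlonglongrightarrow> m + 0 - (1/2) * (norm (y - x))\<^sup>2"
    by (intro tendsto_intros y LIMSEQ_Suc[OF lim_1_over_n])
  then have "h y \<le> m + 0 - (1/2) * (norm (y - x))\<^sup>2"
  proof (rule lower_semicontinuous_le_limit[OF assms(2) y])
    show "h (v n) \<le> m + 1 / real (Suc n) - (1/2) * (norm (v n - x))\<^sup>2" for n
      using v[of n] unfolding F_def by linarith
  qed
  then have "F y \<le> m" by (simp add: F_def)
  then have "is_arg_min F (\<lambda>_. True) y"
    using m order_trans by (auto simp: is_arg_min_def not_less)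
  then have "is_arg_min F (\<lambda>_. True) (prox h x)"
    unfolding prox_def arg_min_def F_def by (rule someI)
  then show ?thesis
    by (simp add: is_arg_min_def F_def not_less)
qed

text \<open>First-order optimality along the segment from \<open>p = prox h x\<close> to \<open>u\<close>: moving by a fraction
  \<open>s\<close> changes the quadratic term by \<open>- s ((x - p) \<bullet> (u - p)) + O(s\<^sup>2)\<close>; divide by \<open>s\<close> and let \<open>s\<close>
  tend to zero.\<close>

lemma prox_residual_subgradient:
  fixes h :: "'a::{real_inner,complete_space} \<Rightarrow> real"
  assumes "convex_on UNIV h" "lower_semicontinuous h"
  shows "x - prox h x \<in> subdifferential h (prox h x)"
proof -
  define p where "p = prox h x"
  have "h p + (x - p) \<bullet> (u - p) \<le> h u" for u
  proof -
    have *: "h p + (x - p) \<bullet> (u - p) \<le> h u + s / 2 * (norm (u - p))\<^sup>2" if s: "0 < s" "s < 1" for s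
    proof -
      define q where "q = (1 - s) *\<^sub>R p + s *\<^sub>R u"
      have "(norm (q - x))\<^sup>2
          = (norm (p - x))\<^sup>2 - 2 * s * ((x - p) \<bullet> (u - p)) + s\<^sup>2 * (norm (u - p))\<^sup>2"
        unfolding power2_norm_eq_inner q_def
        by (simp add: inner_diff_left inner_diff_right inner_add_left inner_add_right
            inner_commute algebra_simps power2_eq_square)
      then have "h p \<le> h q - s * ((x - p) \<bullet> (u - p)) + s\<^sup>2 * (norm (u - p))\<^sup>2 / 2"
        using prox_is_arg_min[OF assms, of x q]
        by (simp add: p_def add_divide_distrib diff_divide_distrib)
      also have "h q \<le> (1 - s) * h p + s * h u"
        unfolding q_def using s by (intro convex_onD[OF assms(1)]) auto
      finally have "s * (h p + (x - p) \<bullet> (u - p)) \<le> s * (h u + s / 2 * (norm (u - p))\<^sup>2)"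
        by (simp add: algebra_simps power2_eq_square)
      then show ?thesis using s by simp
    qed
    have "((\<lambda>s. h u + s / 2 * (norm (u - p))\<^sup>2) \<longlongrightarrow> h u + 0 / 2 * (norm (u - p))\<^sup>2) (at_right 0)"
      by (intro tendsto_intros) auto
    then have "h p + (x - p) \<bullet> (u - p) \<le> h u + 0 / 2 * (norm (u - p))\<^sup>2"
      by (rule tendsto_lowerbound)
         (use * eventually_at_right_less[of 0] in
           \<open>auto simp: eventually_at_right_field intro!: exI[of _ 1]\<close>)
    then show ?thesis by simp
  qed
  then show ?thesis by (simp add: subdifferential_def p_def)
qed

lemma prox_scaled_step:
  fixes h :: "'a::{real_inner,complete_space} \<Rightarrow> real"
  assumes "convex_on UNIV h" "lower_semicontinuous h" "0 < a"
  obtains g where "g \<in> subdifferential h (prox (\<lambda>u. a * h u) x)"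
    "prox (\<lambda>u. a * h u) x = x - a *\<^sub>R g"
proof
  define p where "p = prox (\<lambda>u. a * h u) x"
  define g where "g = (1 / a) *\<^sub>R (x - p)"
  have "x - p \<in> subdifferential (\<lambda>u. a * h u) p"
    unfolding p_def using assms
    by (intro prox_residual_subgradient lower_semicontinuous_cmult convex_on_cmul) auto
  moreover have "x - p = a *\<^sub>R g" using assms(3) by (simp add: g_def)
  ultimately have "a * (h p + g \<bullet> (u - p)) \<le> a * h u" for u
    by (simp add: subdifferential_def distrib_left)
  then show "(1 / a) *\<^sub>R (x - prox (\<lambda>u. a * h u) x) \<in> subdifferential h (prox (\<lambda>u. a * h u) x)"
    using assms(3) by (simp add: subdifferential_def g_def p_def)
  show "prox (\<lambda>u. a * h u) x
      = x - a *\<^sub>R ((1 / a) *\<^sub>R (x - prox (\<lambda>u. a * h u) x))"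
    using assms(3) by simp
qed

text \<open>The proximal step of size \<open>a n = 1 / (n + 1)\<close> yields \<open>g n\<close>, a subgradient of \<open>h\<close> at
  \<open>x - a n g n\<close>. Monotonicity of subgradients makes \<open>\<parallel>g n\<parallel>\<close> increasing and bounds
  \<open>\<parallel>g i - g j\<parallel>\<^sup>2\<close> by the difference of the squared norms. These norms are bounded, so \<open>g\<close> is
  Cauchy, and its limit is a subgradient at \<open>x\<close> by lower semicontinuity.\<close>

lemma subdifferential_nonempty:
  fixes h :: "'a::{real_inner,complete_space} \<Rightarrow> real"
  assumes "convex_on UNIV h" "lower_semicontinuous h"
  shows "subdifferential h x \<noteq> {}"
proof -
  obtain K where K: "K \<ge> 0" "\<And>u. h u \<ge> h x - K * norm (u - x)"
    using convex_lsc_linear_lower_bound[OF assms, of x] by blast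
  define a where "a = (\<lambda>n. 1 / real (Suc n))"
  have a: "a n > 0" for n by (simp add: a_def)
  have "\<exists>g. g \<in> subdifferential h (x - a n *\<^sub>R g)" for n
    using prox_scaled_step[OF assms a, of n x] by metis
  then obtain g where "\<And>n. g n \<in> subdifferential h (x - a n *\<^sub>R g n)" by metis
  then have g: "h (x - a n *\<^sub>R g n) + g n \<bullet> (u - (x - a n *\<^sub>R g n)) \<le> h u" for n u
    by (simp add: subdifferential_def)
  have bound: "norm (g n) \<le> K" for n
  proof -
    have "h (x - a n *\<^sub>R g n) + a n * (g n \<bullet> g n) \<le> h x"
      using g[of n x] by simp
    moreover have "h x - K * (a n * norm (g n)) \<le> h (x - a n *\<^sub>R g n)"
      using K(2)[of "x - a n *\<^sub>R g n"] a[of n] by simp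
    ultimately have "a n * (g n \<bullet> g n) \<le> K * (a n * norm (g n))" by linarith
    then have "a n * (norm (g n) * norm (g n)) \<le> a n * (K * norm (g n))"
      by (metis dot_square_norm power2_eq_square mult.left_commute)
    then have "norm (g n) * norm (g n) \<le> K * norm (g n)"
      using a[of n] by simp
    then show ?thesis
      using K(1) by (cases "g n = 0") auto
  qed
  \<comment> \<open>Add the subgradient inequalities at the two base points and use that \<open>a\<close> decreases.\<close>
  have gap: "(norm (g i - g j))\<^sup>2 \<le> (norm (g j))\<^sup>2 - (norm (g i))\<^sup>2" if "i \<le> j" for i j
  proof -
    have ord: "a j \<le> a i" using that by (simp add: a_def frac_le)
    have "(a i + a j) * (norm (g i - g j))\<^sup>2
        \<le> (a i - a j) * ((norm (g j))\<^sup>2 - (norm (g i))\<^sup>2)"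
      using g[of i "x - a j *\<^sub>R g j"] g[of j "x - a i *\<^sub>R g i"]
      unfolding power2_norm_eq_inner
      by (simp add: inner_diff_left inner_diff_right inner_commute algebra_simps)
    moreover have "(a i - a j) * (norm (g i - g j))\<^sup>2 \<le> (a i + a j) * (norm (g i - g j))\<^sup>2"
      using a[of j] by (intro mult_right_mono) auto
    ultimately have *: "(a i - a j) * (norm (g i - g j))\<^sup>2
        \<le> (a i - a j) * ((norm (g j))\<^sup>2 - (norm (g i))\<^sup>2)" by linarith
    show ?thesis
    proof (cases "i = j")
      case False
      then have "a j < a i" using that by (simp add: a_def frac_less2)
      then show ?thesis using * by simp
    qed simp
  qed
  have "convergent (\<lambda>n. (norm (g n))\<^sup>2)"
  proof (rule Bseq_mono_convergent)
    show "Bseq (\<lambda>n. (norm (g n))\<^sup>2)"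
      using bound by (intro BseqI'[of _ "K\<^sup>2"]) (simp add: power_mono)
    show "\<forall>i j. i \<le> j \<longrightarrow> (norm (g i))\<^sup>2 \<le> (norm (g j))\<^sup>2"
      using gap by (smt (verit) zero_le_power2)
  qed
  then have Cn: "Cauchy (\<lambda>n. (norm (g n))\<^sup>2)" by (simp add: Cauchy_convergent_iff)
  have "Cauchy g"
  proof (rule metric_CauchyI)
    fix e :: real assume e: "0 < e"
    then obtain N where N: "\<And>i j. i \<ge> N \<Longrightarrow> j \<ge> N \<Longrightarrow> dist ((norm (g i))\<^sup>2) ((norm (g j))\<^sup>2) < e\<^sup>2"
      using metric_CauchyD[OF Cn, of "e\<^sup>2"] by auto
    have "dist (g i) (g j) < e" if "i \<ge> N" "j \<ge> N" for i j
    proof -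
      have "(norm (g i - g j))\<^sup>2 \<le> \<bar>(norm (g i))\<^sup>2 - (norm (g j))\<^sup>2\<bar>"
        using gap[of i j] gap[of j i] by (cases "i \<le> j") (auto simp: norm_minus_commute)
      also have "\<dots> < e\<^sup>2" using N[OF that] by (simp add: dist_real_def)
      finally show ?thesis using e by (simp add: dist_norm power2_less_imp_less)
    qed
    then show "\<exists>M. \<forall>i\<ge>M. \<forall>j\<ge>M. dist (g i) (g j) < e" by blast
  qed
  then obtain G where G: "g \<longlonglongrightarrow> G" using Cauchy_convergent_iff convergent_def by blast
  have a0: "a \<longlonglongrightarrow> 0" unfolding a_def by (rule LIMSEQ_Suc[OF lim_1_over_n])
  have lim: "(\<lambda>n. x - a n *\<^sub>R g n) \<longlonglongrightarrow> x - 0 *\<^sub>R G" by (intro tendsto_intros a0 G)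
  have "h x + G \<bullet> (u - x) \<le> h u" for u
  proof -
    have "h (x - 0 *\<^sub>R G) \<le> h u - G \<bullet> (u - (x - 0 *\<^sub>R G))"
    proof (rule lower_semicontinuous_le_limit[OF assms(2) lim])
      show "(\<lambda>n. h u - g n \<bullet> (u - (x - a n *\<^sub>R g n)))
          \<longlonglongrightarrow> h u - G \<bullet> (u - (x - 0 *\<^sub>R G))"
        by (intro tendsto_intros G a0)
      show "h (x - a n *\<^sub>R g n) \<le> h u - g n \<bullet> (u - (x - a n *\<^sub>R g n))" for n
        using g[of n u] by linarith
    qed
    then show ?thesis by simp
  qed
  then show ?thesis by (auto simp: subdifferential_def)
qed

section \<open>The descent inequality of a Douglas--Rachford step\<close>

text \<open>Both \<open>l x - l y\<close> and \<open>r x - r z\<close> are estimated with the subgradients \<open>sl\<close> and \<open>sr\<close> at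
  \<open>x\<close>. Since \<open>x - y = a gl\<close> and \<open>x - z = a (2 gl + gr)\<close>, the estimates cost \<open>a B\<^sup>2\<close> and
  \<open>3 a B\<^sup>2\<close>; together with the factor \<open>2 a\<close> this is the \<open>8 B\<^sup>2 a\<^sup>2\<close> on the right. The terms quadratic
  in \<open>gl\<close> and \<open>gr\<close> combine to \<open>- 2 a\<^sup>2 \<parallel>gl + gr\<parallel>\<^sup>2\<close>, which absorbs the square of the step.\<close>

lemma douglas_rachford_descent:
  fixes l r :: "'a::real_inner \<Rightarrow> real"
  assumes gl: "gl \<in> subdifferential l y" and gr: "gr \<in> subdifferential r z"
    and sl: "sl \<in> subdifferential l x" and sr: "sr \<in> subdifferential r x"
    and y: "y = x - a *\<^sub>R gl" and z: "z = 2 *\<^sub>R y - x - a *\<^sub>R gr"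
    and x': "x' = x + z - y" and a: "0 < a"
    and bounds: "norm gl \<le> B" "norm gr \<le> B" "norm sl \<le> B" "norm sr \<le> B"
  shows "(norm (x' - u))\<^sup>2
    \<le> (norm (x - u))\<^sup>2 - 2 * a * (l x + r x - (l u + r u)) + 8 * B\<^sup>2 * a\<^sup>2"
proof -
  have zx: "z = x - a *\<^sub>R (gl + gl + gr)"
    unfolding z y scaleR_2 by (simp add: algebra_simps)
  have x'x: "x' = x - a *\<^sub>R (gl + gr)"
    unfolding x' zx y by (simp add: algebra_simps scaleR_2)
  have cs: "p \<bullet> q \<le> B\<^sup>2" if "norm p \<le> B" "norm q \<le> B" for p q :: 'a
    using norm_cauchy_schwarz[of p q] mult_mono[OF that] that norm_ge_zero[of p]
    unfolding power2_eq_square by (smt (verit) norm_ge_zero)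
  have "l x - a * (sl \<bullet> gl) + gl \<bullet> (u - x) + a * (gl \<bullet> gl) \<le> l u"
    using gl sl[unfolded subdifferential_def, simplified, rule_format, of y]
    unfolding subdifferential_def y by (auto dest!: spec[of _ u] simp: algebra_simps inner_diff_right)
  moreover have "r x - a * (2 * (sr \<bullet> gl) + sr \<bullet> gr)
      + gr \<bullet> (u - x) + a * (2 * (gr \<bullet> gl) + gr \<bullet> gr) \<le> r u"
    using gr sr[unfolded subdifferential_def, simplified, rule_format, of z]
    unfolding subdifferential_def zx
    by (auto dest!: spec[of _ u] simp: algebra_simps inner_diff_right inner_add_right)
  moreover have "a * (sl \<bullet> gl) \<le> a * B\<^sup>2" "a * (2 * (sr \<bullet> gl) + sr \<bullet> gr) \<le> a * (3 * B\<^sup>2)"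
    using cs[of sl gl] cs[of sr gl] cs[of sr gr] bounds a by auto
  ultimately have "l x + r x - (l u + r u) \<le> (gl + gr) \<bullet> (x - u) + 4 * a * B\<^sup>2
      - a * (gl \<bullet> gl + 2 * (gl \<bullet> gr) + gr \<bullet> gr)"
    by (simp add: algebra_simps inner_diff_right inner_add_left inner_commute)
  moreover have "gl \<bullet> gl + 2 * (gl \<bullet> gr) + gr \<bullet> gr = (norm (gl + gr))\<^sup>2"
    by (simp add: power2_norm_eq_inner inner_add_left inner_add_right inner_commute)
  ultimately have "2 * a * (l x + r x - (l u + r u))
      \<le> 2 * a * ((gl + gr) \<bullet> (x - u) + 4 * a * B\<^sup>2 - a * (norm (gl + gr))\<^sup>2)"
    using a by (intro mult_left_mono) auto
  moreover have "(norm (x' - u))\<^sup>2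
      = (norm (x - u))\<^sup>2 - 2 * a * ((gl + gr) \<bullet> (x - u)) + a\<^sup>2 * (norm (gl + gr))\<^sup>2"
  proof -
    have "x' - u = (x - u) - a *\<^sub>R (gl + gr)" by (simp add: x'x)
    then show ?thesis
      unfolding power2_norm_eq_inner
      by (simp only: inner_diff_left inner_diff_right inner_scaleR_left inner_scaleR_right inner_commute)
         (simp add: algebra_simps power2_eq_square)
  qed
  moreover have "0 \<le> a\<^sup>2 * (norm (gl + gr))\<^sup>2" by simp
  ultimately show ?thesis by (simp add: algebra_simps power2_eq_square)
qed

section \<open>From one-step inequalities to the last iterate\<close>

text \<open>Let \<open>w t = 2 a t (F (x t) - F u)\<close>, let \<open>S k\<close> and \<open>Q k\<close> be the sums of \<open>w\<close> and of
  \<open>a\<^sup>2\<close> over the last \<open>k\<close> indices, and let \<open>H k\<close> be the harmonically weighted sum of \<open>a\<^sup>2\<close>.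
  Telescoping the step inequality from index \<open>T - k\<close> with \<open>x (T - k)\<close> as reference point bounds
  \<open>S (k + 1)\<close> by \<open>(k + 1) w (T - k) + C Q (k + 1)\<close>, hence \<open>S k / k\<close> by
  \<open>S (k + 1) / (k + 1) + C Q (k + 1) / (k (k + 1))\<close>. The accumulated errors add up exactly to
  \<open>C (a T\<^sup>2 + H k - Q k / k)\<close>. For \<open>k = T\<close> the subtracted \<open>C Q T / T\<close> cancels the error of the
  average over all indices.\<close>

lemma last_iterate_bound:
  fixes x :: "nat \<Rightarrow> 'a::real_normed_vector" and F :: "'a \<Rightarrow> real" and a :: "nat \<Rightarrow> real"
  assumes step: "\<And>t u. t \<ge> 1 \<Longrightarrow> (norm (x (t + 1) - u))\<^sup>2
      \<le> (norm (x t - u))\<^sup>2 - 2 * a t * (F (x t) - F u) + C * (a t)\<^sup>2"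
    and decr: "\<And>s t. 1 \<le> s \<Longrightarrow> s \<le> t \<Longrightarrow> a t \<le> a s"
    and min: "\<And>v. F u \<le> F v" and T: "T \<ge> 1"
  shows "2 * a T * (F (x T) - F u)
    \<le> (norm (x 1 - u))\<^sup>2 / T + C * ((a T)\<^sup>2 + (\<Sum>j=1..<T. (a (T - j))\<^sup>2 / j))"
proof -
  define w where "w = (\<lambda>t. 2 * a t * (F (x t) - F u))"
  define S where "S = (\<lambda>k. \<Sum>j<k. w (T - j))"
  define Q where "Q = (\<lambda>k. \<Sum>j<k. (a (T - j))\<^sup>2)"
  define H where "H = (\<lambda>k. \<Sum>j=1..<k. (a (T - j))\<^sup>2 / j)"
  have tele: "(\<Sum>j<k. 2 * a (T - j) * (F (x (T - j)) - F v))
      \<le> (norm (x (T + 1 - k) - v))\<^sup>2 + C * Q k - (norm (x (T + 1) - v))\<^sup>2"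
    if "k \<le> T" for k v
    using that
  proof (induction k)
    case (Suc k)
    have "T + 1 - k = T - k + 1" "T + 1 - Suc k = T - k" using Suc.prems by auto
    then have "(norm (x (T + 1 - k) - v))\<^sup>2 \<le> (norm (x (T + 1 - Suc k) - v))\<^sup>2
        - 2 * a (T - k) * (F (x (T - k)) - F v) + C * (a (T - k))\<^sup>2"
      using step[of "T - k" v] Suc.prems by simp
    moreover have "C * Q (Suc k) = C * Q k + C * (a (T - k))\<^sup>2"
      by (simp add: Q_def distrib_left)
    ultimately show ?case
      using Suc.IH Suc.prems unfolding sum.lessThan_Suc by linarith
  qed (simp add: Q_def)
  have tail: "S (Suc k) \<le> Suc k * w (T - k) + C * Q (Suc k)" if "k < T" for k
  proof -
    have "w (T - j) - w (T - k) \<le> 2 * a (T - j) * (F (x (T - j)) - F (x (T - k)))"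
      if "j < Suc k" for j
    proof -
      \<comment> \<open>Since \<open>F (x (T - k)) \<ge> F u\<close>, the smaller weight \<open>a (T - j)\<close> may replace the one in \<open>w (T - k)\<close>.\<close>
      have "a (T - j) \<le> a (T - k)"
        using that \<open>k < T\<close> by (intro decr) auto
      then have "a (T - j) * (F (x (T - k)) - F u) \<le> a (T - k) * (F (x (T - k)) - F u)"
        using min by (intro mult_right_mono) auto
      then show ?thesis by (simp add: w_def algebra_simps)
    qed
    then have "(\<Sum>j<Suc k. w (T - j) - w (T - k))
        \<le> (\<Sum>j<Suc k. 2 * a (T - j) * (F (x (T - j)) - F (x (T - k))))"
      by (intro sum_mono) simp
    also have "\<dots> \<le> C * Q (Suc k)"
      using tele[of "Suc k" "x (T - k)"] that by (simp add: not_less) (smt (verit) zero_le_power2)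
    finally show ?thesis
      by (simp only: sum_subtractf S_def) simp
  qed
  have avg: "w T \<le> S k / k + C * ((a T)\<^sup>2 + H k - Q k / k)" if "1 \<le> k" "k \<le> T" for k
    using that
  proof (induction k rule: nat_induct_at_least)
    case base
    show ?case by (simp add: S_def Q_def H_def)
  next
    case (Suc k)
    have k: "real k > 0" using Suc.hyps by simp
    have "S (Suc k) = S k + w (T - k)" by (simp add: S_def)
    then have "real (Suc k) * S k \<le> k * S (Suc k) + C * Q (Suc k)"
      using tail[of k] Suc.prems by (simp add: algebra_simps)
    then have "real (Suc k) * S k / (real k * real (Suc k)) \<le> (k * S (Suc k) + C * Q (Suc k)) / (real k * real (Suc k))"
      by (intro divide_right_mono) auto
    also have "\<dots> = S (Suc k) / Suc k + C * (Q (Suc k) / (real k * real (Suc k)))"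
      using k by (simp add: add_divide_distrib del: of_nat_Suc)
    also have "real (Suc k) * S k / (real k * real (Suc k)) = S k / k"
      by (simp del: of_nat_Suc)
    finally have shift: "S k / k \<le> S (Suc k) / Suc k + C * (Q (Suc k) / (real k * real (Suc k)))" .
    have "Q (Suc k) = Q k + (a (T - k))\<^sup>2" "H (Suc k) = H k + (a (T - k))\<^sup>2 / k"
      using Suc.hyps by (simp_all add: Q_def H_def)
    moreover have "Q (Suc k) / (real k * real (Suc k)) = Q (Suc k) / k - Q (Suc k) / Suc k"
      using k by (subst diff_frac_eq) (auto simp: right_diff_distrib[symmetric])
    ultimately have "Q (Suc k) / (real k * real (Suc k)) + (H k - Q k / k)
        = H (Suc k) - Q (Suc k) / Suc k"
      by (simp add: add_divide_distrib)
    then have "Q (Suc k) / (real k * real (Suc k)) + ((a T)\<^sup>2 + H k - Q k / k)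
        = (a T)\<^sup>2 + H (Suc k) - Q (Suc k) / Suc k" by linarith
    then have recombine: "C * (Q (Suc k) / (real k * real (Suc k))) + C * ((a T)\<^sup>2 + H k - Q k / k)
        = C * ((a T)\<^sup>2 + H (Suc k) - Q (Suc k) / Suc k)"
      by (simp only: distrib_left[symmetric])
    show ?case using shift recombine Suc.IH Suc.prems by linarith
  qed
  have "S T \<le> (norm (x 1 - u))\<^sup>2 + C * Q T"
    using tele[of T u] by (simp add: S_def w_def) (smt (verit) zero_le_power2)
  then have "S T / T \<le> (norm (x 1 - u))\<^sup>2 / T + C * (Q T / T)"
    using T by (simp add: field_simps)
  with avg[of T] T show ?thesis
    by (simp add: w_def H_def algebra_simps)
qed

section \<open>The error sums for power step sizes\<close>

text \<open>Comparison with the integral of \<open>s\<^sup>-\<^sup>q\<close>, whose antiderivative is \<open>s\<^sup>1\<^sup>-\<^sup>q / (1 - q)\<close> on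
  both sides of \<open>q = 1\<close>; this form serves \<open>q < 1\<close> and \<open>q > 1\<close> alike.\<close>

lemma sum_powr_neg_le:
  fixes q :: real
  assumes "q \<noteq> 1" "0 \<le> q" "n \<ge> 1"
  shows "(\<Sum>t=1..n. real t powr - q) \<le> 1 + (real n powr (1 - q) - 1) / (1 - q)"
  using assms(3)
proof (induction n rule: nat_induct_at_least)
  case (Suc n)
  have n: "real n \<ge> 1" using Suc.hyps by simp
  have "\<exists>s>real n. s < real n + 1 \<and> (real n + 1) powr (1 - q) / (1 - q) - real n powr (1 - q) / (1 - q)
      = (real n + 1 - real n) * s powr - q"
    using n assms(1) by (intro MVT2) (auto intro!: derivative_eq_intros)
  then obtain s where s: "s > real n" "s < real n + 1"
    "(real n + 1) powr (1 - q) / (1 - q) - real n powr (1 - q) / (1 - q) = s powr - q" by auto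
  have "(real n + 1) powr - q \<le> s powr - q"
    using s n assms(2) by (intro powr_mono2') auto
  then show ?case
    using Suc.IH s(3) by (simp add: diff_divide_distrib add.commute)
qed simp

lemma sum_inverse_le:
  assumes "n \<ge> 1"
  shows "(\<Sum>t=1..n. 1 / real t) \<le> 1 + ln (real n)"
  using assms
proof (induction n rule: nat_induct_at_least)
  case (Suc n)
  have n: "real n \<ge> 1" using Suc.hyps by simp
  have "ln (real n / (real n + 1)) \<le> real n / (real n + 1) - 1"
    using n by (intro ln_le_minus_one) auto
  then have "1 / (real n + 1) \<le> ln (real n + 1) - ln (real n)"
    using n by (simp add: ln_div field_simps)
  then show ?case using Suc.IH by (simp add: add.commute)
qed simp

text \<open>Each summand is at most the sum of two terms, whichever half of the range \<open>j\<close> is in: for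
  \<open>2 j \<le> T\<close> the power is at most \<open>2\<^sup>q T\<^sup>-\<^sup>q\<close>, and otherwise \<open>1 / j\<close> is at most \<open>2 / T\<close>.\<close>

lemma weighted_step_sum_le:
  fixes q :: real
  assumes q: "0 \<le> q" and T: "T \<ge> 1"
  shows "real T powr - q + (\<Sum>j=1..<T. real (T - j) powr - q / j)
    \<le> real T powr - q * (1 + 2 powr q * (1 + ln T)) + 2 / T * (\<Sum>t=1..T. real t powr - q)"
proof -
  have "real (T - j) powr - q / j \<le> 2 powr q * real T powr - q * (1 / j) + 2 / T * real (T - j) powr - q"
    if "j \<in> {1..<T}" for j
  proof (cases "2 * j \<le> T")
    case True
    have "real (T - j) powr - q \<le> (real T / 2) powr - q"
      using True that q by (intro powr_mono2') auto
    also have "\<dots> = 2 powr q * real T powr - q"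
      by (simp add: powr_divide powr_minus field_simps)
    finally have "real (T - j) powr - q / j \<le> 2 powr q * real T powr - q * (1 / j)"
      by (simp add: divide_right_mono)
    then show ?thesis by (smt (verit) powr_ge_zero divide_nonneg_nonneg mult_nonneg_nonneg of_nat_0_le_iff)
  next
    case False
    then have "1 / real j \<le> 2 / T"
      using that by (simp add: field_simps)
    then have "real (T - j) powr - q * (1 / real j) \<le> real (T - j) powr - q * (2 / T)"
      by (intro mult_left_mono) auto
    then have "real (T - j) powr - q / j \<le> 2 / T * real (T - j) powr - q"
      by (simp add: mult.commute)
    moreover have "0 \<le> 2 powr q * real T powr - q * (1 / j)" by simp
    ultimately show ?thesis by linarith
  qed
  then have "(\<Sum>j=1..<T. real (T - j) powr - q / j)
      \<le> (\<Sum>j=1..<T. 2 powr q * real T powr - q * (1 / j) + 2 / T * real (T - j) powr - q)"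
    by (intro sum_mono) auto
  also have "\<dots> = 2 powr q * real T powr - q * (\<Sum>j=1..<T. 1 / j)
      + 2 / T * (\<Sum>j=1..<T. real (T - j) powr - q)"
    by (simp only: sum.distrib sum_distrib_left)
  also have "(\<Sum>j=1..<T. real (T - j) powr - q) = (\<Sum>t=1..<T. real t powr - q)"
    by (rule sum.reindex_bij_witness[of _ "\<lambda>t. T - t" "\<lambda>t. T - t"]) auto
  also have "2 / T * (\<Sum>t=1..<T. real t powr - q) \<le> 2 / T * (\<Sum>t=1..T. real t powr - q)"
    by (intro mult_left_mono sum_mono2) auto
  also have "2 powr q * real T powr - q * (\<Sum>j=1..<T. 1 / j) \<le> 2 powr q * real T powr - q * (1 + ln T)"
  proof (intro mult_left_mono)
    have "(\<Sum>j=1..<T. 1 / real j) \<le> (\<Sum>j=1..T. 1 / real j)"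
      by (intro sum_mono2) auto
    also have "\<dots> \<le> 1 + ln T" using T by (intro sum_inverse_le) auto
    finally show "(\<Sum>j=1..<T. 1 / real j) \<le> 1 + ln T" .
  qed auto
  finally show ?thesis by (simp add: algebra_simps)
qed

text \<open>For \<open>q \<le> 1\<close> the logarithm comes from the harmonic sum and \<open>T > 3\<close> ensures \<open>ln T \<ge> 1\<close>, so
  that constants can be multiplied by it. For \<open>q > 1\<close> it is absorbed by the spare factor
  \<open>T\<^sup>1\<^sup>-\<^sup>q\<close> through \<open>ln T \<le> T\<^sup>q\<^sup>-\<^sup>1 / (q - 1)\<close>. The bound \<open>q \<le> 2\<close> keeps \<open>2\<^sup>q (q - 1)\<close> below \<open>2\<^sup>q\<close>.\<close>

lemma weighted_step_sum_rate:
  fixes q :: real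
  assumes q: "0 \<le> q" "q \<le> 2" and T: "T > 3"
  shows "real T powr - q + (\<Sum>j=1..<T. real (T - j) powr - q / j)
    \<le> 2 * c_const q * ln (real T) ^ (if q \<le> 1 then 1 else 0) * real T powr - min q 1"
proof -
  define L where "L = ln (real T)"
  define P where "P = real T powr - q"
  define A where "A = (\<Sum>t=1..T. real t powr - q)"
  have "ln 3 \<le> L" using T by (simp add: L_def)
  then have L: "L \<ge> 1" using ln3_gt_1 by linarith
  have P: "P > 0" using T by (simp add: P_def)
  have base: "real T powr - q + (\<Sum>j=1..<T. real (T - j) powr - q / j)
      \<le> P * (1 + 2 powr q * (1 + L)) + 2 / T * A"
    unfolding P_def L_def A_def using q T by (intro weighted_step_sum_le) auto
  have PT: "real T powr (1 - q) = P * T" using T by (simp add: P_def powr_diff powr_minus field_simps)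
  consider "q < 1" | "q = 1" | "q > 1" by linarith
  then show ?thesis
  proof cases
    case 1
    have "A \<le> 1 + (P * T - 1) / (1 - q)"
      unfolding A_def PT[symmetric] using 1 q T by (intro sum_powr_neg_le) auto
    also have "\<dots> \<le> P * T / (1 - q)"
    proof -
      have "1 \<le> 1 / (1 - q)" using 1 q by simp
      then show ?thesis by (simp add: diff_divide_distrib)
    qed
    finally have "2 / T * A \<le> 2 / T * (P * T / (1 - q))" by (intro mult_left_mono) auto
    then have "2 / T * A \<le> P * (2 / (1 - q))" using T by (simp add: mult.commute)
    moreover have "2 powr q \<le> 2 powr 1" using 1 by (intro powr_mono) auto
    then have "P * (1 + 2 powr q * (1 + L)) \<le> P * (1 + 2 * (1 + L))"
      using P L by (intro mult_left_mono add_left_mono mult_right_mono) auto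
    moreover have "P * (2 / (1 - q)) \<le> P * (2 / (1 - q) * L)"
      using P L 1 by (intro mult_left_mono mult_le_cancel_left1[THEN iffD2]) auto
    moreover have "P * (1 + 2 * (1 + L)) \<le> P * (5 * L)" using P L by (intro mult_left_mono) auto
    ultimately have "P * (1 + 2 powr q * (1 + L)) + 2 / T * A \<le> P * ((5 + 2 / (1 - q)) * L)"
      by (simp add: algebra_simps)
    also have "\<dots> \<le> 2 * (P * ((5 + 2 / (1 - q)) * L))" using P L 1 by simp
    finally show ?thesis using base 1
      by (simp add: c_const_def L_def P_def algebra_simps)
  next
    case 2
    have "A \<le> 1 + L"
      unfolding A_def L_def 2 using sum_inverse_le[of T] T by (simp add: powr_minus divide_inverse)
    then have "2 / T * A \<le> 2 / T * (1 + L)" by (intro mult_left_mono) auto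
    moreover have PP: "2 / T = 2 * P" using T 2 by (simp add: P_def powr_minus divide_inverse)
    ultimately have "P * (1 + 2 powr q * (1 + L)) + 2 / T * A \<le> P * (5 + 4 * L)"
      unfolding PP using 2 by (simp add: algebra_simps)
    also have "\<dots> \<le> P * (2 * 9 * L)" using P L by (intro mult_left_mono) auto
    finally show ?thesis using base 2
      by (simp add: c_const_def L_def P_def algebra_simps)
  next
    case 3
    have "A \<le> 1 + (P * T - 1) / (1 - q)"
      unfolding A_def PT[symmetric] using 3 q T by (intro sum_powr_neg_le) auto
    also have "\<dots> = 1 + (1 - P * T) / (q - 1)" using 3 by (simp add: field_simps)
    also have "\<dots> \<le> 1 + 1 / (q - 1)" using 3 P by (intro add_left_mono divide_right_mono) auto
    also have "\<dots> = q / (q - 1)" using 3 by (simp add: field_simps)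
    finally have A: "A \<le> q / (q - 1)" .
    have PT1: "P * T \<le> 1"
      unfolding PT[symmetric] using powr_mono[of "1 - q" 0 "real T"] 3 T by simp
    have "L \<le> real T powr (q - 1) / (q - 1)"
      unfolding L_def using 3 T by (intro ln_powr_bound) auto
    then have "P * T * L \<le> P * T * (real T powr (q - 1) / (q - 1))"
      using P by (intro mult_left_mono) auto
    also have "\<dots> = real T powr (1 - q) * real T powr (q - 1) / (q - 1)"
      unfolding PT by simp
    also have "real T powr (1 - q) * real T powr (q - 1) = 1"
      using T by (simp add: powr_add[symmetric])
    finally have PL: "P * T * L \<le> 1 / (q - 1)" .
    have "T * (P * (1 + 2 powr q * (1 + L)) + 2 / T * A)
        = P * T * (1 + 2 powr q) + 2 powr q * (P * T * L) + 2 * A"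
      using T by (simp add: field_simps)
    also have "\<dots> \<le> 1 * (1 + 2 powr q) + 2 powr q * (1 / (q - 1)) + 2 * (q / (q - 1))"
      using A PT1 PL by (intro add_mono mult_mono mult_left_mono) auto
    also have "\<dots> = ((1 + 2 powr q) * (q - 1) + 2 powr q + 2 * q) / (q - 1)"
      using 3 by (simp add: add_divide_distrib)
    also have "\<dots> \<le> (2 * (2 powr q + 3 * q - 1)) / (q - 1)"
    proof (rule divide_right_mono)
      have "0 \<le> (2 - q) * 2 powr q + (3 * q - 1)"
        using q 3 by (intro add_nonneg_nonneg mult_nonneg_nonneg) auto
      also have "\<dots> = 2 * (2 powr q + 3 * q - 1) - ((1 + 2 powr q) * (q - 1) + 2 powr q + 2 * q)"
        by (simp add: algebra_simps)
      finally show "(1 + 2 powr q) * (q - 1) + 2 powr q + 2 * q \<le> 2 * (2 powr q + 3 * q - 1)"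
        by (rule diff_ge_0_iff_ge[THEN iffD1])
    qed (use 3 in auto)
    also have "\<dots> = 2 * c_const q" using 3 by (simp add: c_const_def)
    finally have "P * (1 + 2 powr q * (1 + L)) + 2 / T * A \<le> 2 * c_const q / T"
      using T by (simp add: field_simps)
    then show ?thesis using base 3 T
      by (simp add: min_def powr_minus divide_inverse)
  qed
qed

section \<open>The convergence rate\<close>

theorem theorem3p6:
  fixes l r f :: "'a::{real_inner, complete_space} \<Rightarrow> real"
    and x y z :: "nat \<Rightarrow> 'a"
    and \<alpha> \<theta> B :: real
    and \<alpha>s :: "nat \<Rightarrow> real"
    and T :: nat
  assumes l: "convex_on UNIV l" "lower_semicontinuous l"
    and r: "convex_on UNIV r" "lower_semicontinuous r"
    and f: "f = (\<lambda>u. l u + r u)"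
    and min: "minimizers f \<noteq> {}"
    and \<alpha>: "0 < \<alpha>"
    and \<theta>: "0 < \<theta>" "\<theta> < 1"
    and \<alpha>s: "\<And>t. t \<ge> 1 \<Longrightarrow> \<alpha>s t = \<alpha> * real t powr (- \<theta>)"
    and y: "\<And>t. t \<ge> 1 \<Longrightarrow> y (t + 1) = prox (\<lambda>u. \<alpha>s t * l u) (x t)"
    and z: "\<And>t. t \<ge> 1 \<Longrightarrow> z (t + 1) = prox (\<lambda>u. \<alpha>s t * r u) (2 *\<^sub>R y (t + 1) - x t)"
    and x: "\<And>t. t \<ge> 1 \<Longrightarrow> x (t + 1) = x t + z (t + 1) - y (t + 1)"
    and B: "0 < B"
    and B_x: "\<And>t g. t \<ge> 1 \<Longrightarrow> g \<in> subdifferential l (x t) \<union> subdifferential r (x t) \<Longrightarrow> norm g \<le> B"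
    and B_yz: "\<And>t g. t \<ge> 2 \<Longrightarrow> g \<in> subdifferential l (y t) \<union> subdifferential r (z t) \<Longrightarrow> norm g \<le> B"
    and T: "T > 3"
  shows "f (x T) - min_value f
    \<le> (infdist (x 1) (minimizers f))\<^sup>2 / (2 * \<alpha>) * real T powr (\<theta> - 1)
      + 8 * \<alpha> * B\<^sup>2 * c_const (2 * \<theta>)
        * ln (real T) ^ (if 2 * \<theta> \<le> 1 then 1 else 0)
        * real T powr (- min \<theta> (1 - \<theta>))"
proof -
  have pos: "0 < \<alpha>s t" if "t \<ge> 1" for t using \<alpha>s[OF that] \<alpha> that by simp
  have decr: "\<alpha>s t \<le> \<alpha>s s" if "1 \<le> s" "s \<le> t" for s t
    using \<alpha>s[of s] \<alpha>s[of t] that \<alpha> \<theta> by (auto intro!: mult_left_mono powr_mono2')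
  have sq: "(\<alpha>s t)\<^sup>2 = \<alpha>\<^sup>2 * real t powr - (2 * \<theta>)" if "t \<ge> 1" for t
    using \<alpha>s[OF that] that by (simp add: power_mult_distrib powr_power)
  have step: "(norm (x (t + 1) - u))\<^sup>2
      \<le> (norm (x t - u))\<^sup>2 - 2 * \<alpha>s t * (f (x t) - f u) + 8 * B\<^sup>2 * (\<alpha>s t)\<^sup>2"
    if t: "t \<ge> 1" for t u
  proof -
    obtain gl where gl: "gl \<in> subdifferential l (y (t + 1))" "y (t + 1) = x t - \<alpha>s t *\<^sub>R gl"
      using prox_scaled_step[OF l pos[OF t], of "x t"] y[OF t] by metis
    obtain gr where gr: "gr \<in> subdifferential r (z (t + 1))"
      "z (t + 1) = 2 *\<^sub>R y (t + 1) - x t - \<alpha>s t *\<^sub>R gr"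
      using prox_scaled_step[OF r pos[OF t], of "2 *\<^sub>R y (t + 1) - x t"] z[OF t] by metis
    obtain sl sr where s: "sl \<in> subdifferential l (x t)" "sr \<in> subdifferential r (x t)"
      using subdifferential_nonempty[OF l] subdifferential_nonempty[OF r] by blast
    have "norm gl \<le> B" "norm gr \<le> B" "norm sl \<le> B" "norm sr \<le> B"
      using B_yz[of "t + 1"] B_x[of t] t gl(1) gr(1) s by auto
    then show ?thesis
      unfolding f using gl gr s x[OF t] pos[OF t] by (intro douglas_rachford_descent)
  qed
  define E where "E = f (x T) - min_value f"
  define W where "W = real T powr - (2 * \<theta>) + (\<Sum>j=1..<T. real (T - j) powr - (2 * \<theta>) / j)"
  \<comment> \<open>The error term after division by \<open>2 \<alpha>\<^sub>T\<close>.\<close>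
  define N where "N = 4 * \<alpha> * B\<^sup>2 * real T powr \<theta> * W"
  have via: "E \<le> (norm (x 1 - u))\<^sup>2 / (2 * \<alpha>) * real T powr (\<theta> - 1) + N"
    if u: "u \<in> minimizers f" for u
  proof -
    have le: "f u \<le> f v" for v
      using u by (auto simp: minimizers_def is_arg_min_def not_less)
    then have "min_value f = f u"
      unfolding min_value_def by (intro cInf_eq_minimum) auto
    then have "2 * \<alpha>s T * E
        \<le> (norm (x 1 - u))\<^sup>2 / T + 8 * B\<^sup>2 * ((\<alpha>s T)\<^sup>2 + (\<Sum>j=1..<T. (\<alpha>s (T - j))\<^sup>2 / j))"
      unfolding E_def using T le decr step
      by (intro order_trans[OF _ last_iterate_bound[where F = f and a = \<alpha>s and x = x]])
         (auto intro: less_imp_le)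
    also have "(\<Sum>j=1..<T. (\<alpha>s (T - j))\<^sup>2 / j)
        = \<alpha>\<^sup>2 * (\<Sum>j=1..<T. real (T - j) powr - (2 * \<theta>) / j)"
      unfolding sum_distrib_left by (intro sum.cong refl) (subst sq, auto)
    also have "(\<alpha>s T)\<^sup>2 + \<alpha>\<^sup>2 * (\<Sum>j=1..<T. real (T - j) powr - (2 * \<theta>) / j) = \<alpha>\<^sup>2 * W"
      using T sq[of T] by (simp add: W_def distrib_left)
    finally have "real T powr \<theta> / (2 * \<alpha>) * (2 * \<alpha>s T * E)
        \<le> real T powr \<theta> / (2 * \<alpha>) * ((norm (x 1 - u))\<^sup>2 / T + 8 * B\<^sup>2 * (\<alpha>\<^sup>2 * W))"
      using \<alpha> by (intro mult_left_mono) auto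
    moreover have "real T powr \<theta> / (2 * \<alpha>) * (2 * \<alpha>s T * E) = E"
      using \<alpha>s[of T] T \<alpha> by (simp add: powr_minus)
    moreover have "real T powr \<theta> / (2 * \<alpha>) * ((norm (x 1 - u))\<^sup>2 / T + 8 * B\<^sup>2 * (\<alpha>\<^sup>2 * W))
        = (norm (x 1 - u))\<^sup>2 / (2 * \<alpha>) * real T powr (\<theta> - 1) + N"
      using T \<alpha> by (simp add: N_def powr_diff distrib_left power2_eq_square)
    ultimately show ?thesis by simp
  qed
  \<comment> \<open>Taking square roots turns the infimum over \<open>u\<close> into an infimum of distances.\<close>
  have main: "E \<le> (infdist (x 1) (minimizers f))\<^sup>2 / (2 * \<alpha>) * real T powr (\<theta> - 1) + N"
  proof -
    define c where "c = real T powr (\<theta> - 1) / (2 * \<alpha>)"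
    have c: "c > 0" using \<alpha> T by (simp add: c_def)
    have "sqrt ((E - N) / c) \<le> dist (x 1) u" if "u \<in> minimizers f" for u
    proof (rule real_le_lsqrt)
      show "(E - N) / c \<le> (dist (x 1) u)\<^sup>2"
        unfolding pos_divide_le_eq[OF c] using via[OF that] by (simp add: c_def dist_norm)
    qed simp
    then have "sqrt ((E - N) / c) \<le> infdist (x 1) (minimizers f)"
      unfolding infdist_notempty[OF min] by (intro cINF_greatest min)
    then have "(E - N) / c \<le> (infdist (x 1) (minimizers f))\<^sup>2"
      by (rule sqrt_le_D)
    then have "E - N \<le> (infdist (x 1) (minimizers f))\<^sup>2 * c"
      using c by (simp add: pos_divide_le_eq)
    then show ?thesis by (simp add: c_def)
  qed
  define R where "R = 2 * c_const (2 * \<theta>) * ln (real T) ^ (if 2 * \<theta> \<le> 1 then 1 else 0)"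
  have "W \<le> R * real T powr - min (2 * \<theta>) 1"
    unfolding W_def R_def using \<theta> T by (intro weighted_step_sum_rate) auto
  then have "N \<le> 4 * \<alpha> * B\<^sup>2 * real T powr \<theta> * (R * real T powr - min (2 * \<theta>) 1)"
    unfolding N_def using \<alpha> by (intro mult_left_mono) auto
  also have "\<dots> = 4 * \<alpha> * B\<^sup>2 * R * (real T powr \<theta> * real T powr - min (2 * \<theta>) 1)"
    by simp
  also have "real T powr \<theta> * real T powr - min (2 * \<theta>) 1 = real T powr - min \<theta> (1 - \<theta>)"
    unfolding powr_add[symmetric] by (intro arg_cong[of _ _ "\<lambda>p. real T powr p"]) linarith
  finally have "N \<le> 8 * \<alpha> * B\<^sup>2 * c_const (2 * \<theta>)
      * ln (real T) ^ (if 2 * \<theta> \<le> 1 then 1 else 0) * real T powr - min \<theta> (1 - \<theta>)"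
    by (simp add: R_def mult_ac)
  with main show ?thesis unfolding E_def by linarith
qed

end
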